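(* Let $H$ be an infinite-dimensional separable complex Hilbert space and let $T\in\mathcal{B}(H)$ be a WEP operator, i.e. $R(T)=R(T^* )$. Then $T\in\mathcal{M}_r(H)$ if and only if $T^*\in\mathcal{M}_r(H)$.
   Context: $\mathcal{B}(H)$ denotes the bounded linear operators on $H$; $R(T)$ is the range of $T$ (not assumed closed). For a nonzero Hilbert space $M$ and $A\in\mathcal{B}(M)$, the minimum modulus is $m(A)=\inf\{\|Ax\|: x\in M,\ \|x\|=1\}$; $A$ is minimum attaining if there is a unit vector $x_0\in M$ with $\|Ax_0\|=m(A)$. A closed subspace $M\subseteq H$ reduces $T\in\mathcal{B}(H)$ if $T(M)\subseteq M$ and $T^*(M)\subseteq M$. $\mathcal{M}_r(H)$ is the set of all $T\in\mathcal{B}(H)$ such that for every nonzero closed subspace $M$ reducing $T$, the restriction $T|_M:M\to M$ is minimum attaining. *)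

theory Defs
  imports "HOL-Analysis.Analysis"
begin

section \<open>Complex Hilbert spaces\<close>

text \<open>
  A complex inner product space is presented as a real one with a compatible complex structure.
  The real inner product inherited from \<^class>\<open>real_inner\<close> is the real part of
  the complex one; as \<open>cinner x x\<close> is real by conjugate symmetry, it equals
  \<open>inner x x\<close>, so positive definiteness of \<open>cinner\<close> and the fact that the norm
  and the topology are those induced by \<open>cinner\<close> come from \<^class>\<open>real_inner\<close>.
  The form \<open>cinner\<close> is linear in its first argument.
\<close>

class complex_inner = real_inner +
  fixes scaleC :: "complex \<Rightarrow> 'a \<Rightarrow> 'a"  (infixr \<open>*\<^sub>C\<close> 75)
    and cinner :: "'a \<Rightarrow> 'a \<Rightarrow> complex"
  assumes scaleC_add_right: "a *\<^sub>C (x + y) = a *\<^sub>C x + a *\<^sub>C y"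
    and scaleC_add_left: "(a + b) *\<^sub>C x = a *\<^sub>C x + b *\<^sub>C x"
    and scaleC_scaleC: "a *\<^sub>C (b *\<^sub>C x) = (a * b) *\<^sub>C x"
    and scaleC_one: "1 *\<^sub>C x = x"
    and scaleR_scaleC: "scaleR r x = complex_of_real r *\<^sub>C x"
    and cinner_commute: "cinner x y = cnj (cinner y x)"
    and cinner_add_left: "cinner (x + y) z = cinner x z + cinner y z"
    and cinner_scaleC_left: "cinner (a *\<^sub>C x) y = a * cinner x y"
    and inner_eq_Re_cinner: "inner x y = Re (cinner x y)"

class chilbert_space = complex_inner + complete_space

global_interpretation complex_vector: vector_space "scaleC :: complex \<Rightarrow> 'a \<Rightarrow> 'a::complex_inner"
  defines csubspace = complex_vector.subspace
    and cspan = complex_vector.span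
  by unfold_locales (rule scaleC_add_right scaleC_add_left scaleC_scaleC scaleC_one)+

definition infinite_dimensional :: "'a::complex_inner itself \<Rightarrow> bool" where
  "infinite_dimensional _ \<longleftrightarrow> (\<nexists>B :: 'a set. finite B \<and> cspan B = UNIV)"

section \<open>Bounded operators, adjoints and reducing subspaces\<close>

definition bounded_clinear :: "('a::complex_inner \<Rightarrow> 'a) \<Rightarrow> bool" where
  "bounded_clinear T \<longleftrightarrow> bounded_linear T \<and> (\<forall>a x. T (a *\<^sub>C x) = a *\<^sub>C T x)"

text \<open>
  For a bounded operator on a Hilbert space the function selected here exists (Riesz) and is
  unique; compare \<^const>\<open>adjoint\<close> for real inner products.
\<close>

definition cadjoint :: "('a::chilbert_space \<Rightarrow> 'a) \<Rightarrow> 'a \<Rightarrow> 'a" where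
  "cadjoint T = (SOME S. \<forall>x y. cinner (T x) y = cinner x (S y))"

definition reduces :: "'a::chilbert_space set \<Rightarrow> ('a \<Rightarrow> 'a) \<Rightarrow> bool" where
  "reduces M T \<longleftrightarrow> T ` M \<subseteq> M \<and> cadjoint T ` M \<subseteq> M"

definition wep :: "('a::chilbert_space \<Rightarrow> 'a) \<Rightarrow> bool" where
  "wep T \<longleftrightarrow> range T = range (cadjoint T)"

section \<open>Minimum modulus\<close>

text \<open>
  The restriction of an operator \<open>A\<close> to a subspace \<open>M\<close> is represented by the
  pair of \<open>M\<close> and \<open>A\<close>. For \<open>M \<noteq> {0}\<close> the set of norms
  below is nonempty and bounded below by 0, so the real infimum is the intended one.
\<close>

definition min_modulus_on :: "'a::complex_inner set \<Rightarrow> ('a \<Rightarrow> 'a) \<Rightarrow> real" where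
  "min_modulus_on M A = Inf {norm (A x) | x. x \<in> M \<and> norm x = 1}"

definition minimum_attaining_on :: "'a::complex_inner set \<Rightarrow> ('a \<Rightarrow> 'a) \<Rightarrow> bool" where
  "minimum_attaining_on M A \<longleftrightarrow> (\<exists>x0\<in>M. norm x0 = 1 \<and> norm (A x0) = min_modulus_on M A)"

definition reducing_minimum_attaining :: "('a::chilbert_space \<Rightarrow> 'a) set"  (\<open>\<M>\<^sub>r\<close>) where
  "\<M>\<^sub>r = {T. bounded_clinear T \<and>
     (\<forall>M. csubspace M \<and> closed M \<and> M \<noteq> {0} \<and> reduces M T \<longrightarrow> minimum_attaining_on M T)}"

end

theory Submission
  imports Defs
begin

text \<open>
  Since \<open>R(T) = R(T\<^sup>*)\<close>, the kernels of \<open>T\<close> and \<open>T\<^sup>*\<close> coincide. On a reducing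
  subspace \<open>M\<close> meeting this kernel both minimum moduli are attained with value 0. Otherwise
  \<open>T\<close> attains \<open>m = m(T|M) > 0\<close> at some \<open>x\<^sub>0\<close>, so \<open>T|M\<close> has closed range, which is
  dense in \<open>M\<close> because \<open>T\<^sup>*|M\<close> is injective. From \<open>y = T x\<close> and
  \<open>\<parallel>y\<parallel>\<^sup>2 = \<langle>x, T\<^sup>*y\<rangle>\<close> one gets \<open>\<parallel>T\<^sup>*y\<parallel> \<ge> m\<parallel>y\<parallel>\<close> on \<open>M\<close>; as \<open>x\<^sub>0\<close> minimises
  the quadratic form of \<open>T\<^sup>*T\<close>, it satisfies \<open>T\<^sup>*T x\<^sub>0 = m\<^sup>2 x\<^sub>0\<close>, and equality holds at
  \<open>y = T x\<^sub>0\<close>.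
\<close>

section \<open>Orthogonal projection, Riesz representation and adjoints for real inner
  products\<close>

lemma norm_add_scaleR_power2:
  "(norm (x + t *\<^sub>R y))\<^sup>2 = (norm x)\<^sup>2 + 2 * t * inner x y + t\<^sup>2 * (norm y)\<^sup>2"
  by (simp add: power2_norm_eq_inner inner_commute power2_eq_square[of t] algebra_simps)

text \<open>A sequence in \<open>M\<close> minimising the distance to \<open>x\<close> is Cauchy by
  the parallelogram law; its limit is the nearest point, and nearness forces orthogonality.
  Completeness is asked of \<open>M\<close> alone, not of the ambient space.\<close>

lemma complete_subspace_projection:
  fixes M :: "'a::real_inner set"
  assumes sub: "subspace M" and compl: "complete M"
  obtains y where "y \<in> M" "\<And>z. z \<in> M \<Longrightarrow> inner (x - y) z = 0"
proof -
  define d where "d = infdist x M"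
  have ne: "M \<noteq> {}" using sub subspace_0 by blast
  have d0: "d \<ge> 0" by (simp add: d_def infdist_nonneg)
  have dle: "d\<^sup>2 \<le> (norm (x - z))\<^sup>2" if "z \<in> M" for z
    using infdist_le[OF that, of x] d0 by (simp add: d_def dist_norm power_mono)
  have "\<exists>y\<in>M. (norm (x - y))\<^sup>2 < d\<^sup>2 + inverse (real (Suc n))" for n
  proof -
    have "d < sqrt (d\<^sup>2 + inverse (real (Suc n)))"
      by (rule real_less_rsqrt) simp
    then obtain y where y: "y \<in> M" "dist x y < sqrt (d\<^sup>2 + inverse (real (Suc n)))"
      unfolding d_def infdist_notempty[OF ne]
      by (subst (asm) cInf_less_iff) (use ne in \<open>auto intro!: bdd_belowI[of _ 0]\<close>)
    have "(dist x y)\<^sup>2 < (sqrt (d\<^sup>2 + inverse (real (Suc n))))\<^sup>2"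
      using y(2) by (intro power_strict_mono) auto
    also have "\<dots> = d\<^sup>2 + inverse (real (Suc n))"
      by (intro real_sqrt_pow2) simp
    finally show ?thesis using y(1) by (auto simp: dist_norm)
  qed
  then obtain Y where YM: "\<And>n. Y n \<in> M"
    and Y: "\<And>n. (norm (x - Y n))\<^sup>2 < d\<^sup>2 + inverse (real (Suc n))"
    by metis
  have par: "(norm (Y m - Y n))\<^sup>2 < 2 * inverse (real (Suc m)) + 2 * inverse (real (Suc n))" for m n
  proof -
    \<comment> \<open>Parallelogram law for \<open>x - Y m\<close> and \<open>x - Y n\<close>: the
      midpoint lies in \<open>M\<close>, so its squared distance from \<open>x\<close> is at least
      \<open>d\<^sup>2\<close>, and only the two errors remain.\<close>
    let ?c = "(1/2) *\<^sub>R (Y m + Y n)"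
    have "?c \<in> M" by (intro subspace_scale subspace_add sub YM)
    then have "d\<^sup>2 \<le> (norm (x - ?c))\<^sup>2" by (rule dle)
    moreover have "(norm (Y m - Y n))\<^sup>2 + 4 * (norm (x - ?c))\<^sup>2
        = 2 * (norm (x - Y m))\<^sup>2 + 2 * (norm (x - Y n))\<^sup>2"
      by (simp add: power2_norm_eq_inner inner_commute algebra_simps)
    ultimately show ?thesis using Y[of m] Y[of n] by linarith
  qed
  have "Cauchy Y"
  proof (rule metric_CauchyI)
    fix e :: real assume e: "e > 0"
    then obtain N where N: "inverse (real (Suc N)) < e\<^sup>2 / 4"
      using reals_Archimedean[of "e\<^sup>2 / 4"] by auto
    have "dist (Y m) (Y n) < e" if "m \<ge> N" "n \<ge> N" for m n
    proof -
      have "inverse (real (Suc m)) \<le> inverse (real (Suc N))"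
        "inverse (real (Suc n)) \<le> inverse (real (Suc N))"
        using that by (auto intro!: le_imp_inverse_le)
      then have "(norm (Y m - Y n))\<^sup>2 < e\<^sup>2" using par[of m n] N by linarith
      then show ?thesis using e by (simp add: dist_norm power2_less_imp_less)
    qed
    then show "\<exists>N. \<forall>m\<ge>N. \<forall>n\<ge>N. dist (Y m) (Y n) < e" by blast
  qed
  then obtain y where y: "y \<in> M" "Y \<longlonglongrightarrow> y"
    using compl YM unfolding complete_def by meson
  have "(\<lambda>n. (norm (x - Y n))\<^sup>2) \<longlonglongrightarrow> (norm (x - y))\<^sup>2"
    by (intro tendsto_intros y)
  moreover have "(\<lambda>n. d\<^sup>2 + inverse (real (Suc n))) \<longlonglongrightarrow> d\<^sup>2 + 0"
    by (intro tendsto_intros LIMSEQ_inverse_real_of_nat)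
  ultimately have yd: "(norm (x - y))\<^sup>2 \<le> d\<^sup>2"
    using Y by (auto intro: LIMSEQ_le less_imp_le)
  have "inner (x - y) z = 0" if z: "z \<in> M" for z
  proof (cases "z = 0")
    case False
    \<comment> \<open>The value of \<open>t\<close> that minimises the norm of
      \<open>x - (y + t *\<^sub>R z)\<close>.\<close>
    let ?t = "inner (x - y) z / inner z z"
    have "(norm (x - y))\<^sup>2 \<le> (norm (x - (y + ?t *\<^sub>R z)))\<^sup>2"
      by (rule order_trans[OF yd dle]) (use y z sub in \<open>auto intro: subspace_add subspace_scale\<close>)
    also have "\<dots> = (norm (x - y))\<^sup>2 - 2 * ?t * inner (x - y) z + ?t\<^sup>2 * inner z z"
      using norm_add_scaleR_power2[of "x - y" "- ?t" z]
      by (simp add: power2_norm_eq_inner[of z] diff_diff_eq)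
    also have "\<dots> = (norm (x - y))\<^sup>2 - (inner (x - y) z)\<^sup>2 / inner z z"
      using False by (simp add: power2_eq_square)
    finally have "(inner (x - y) z)\<^sup>2 / inner z z \<le> 0" by simp
    moreover have "inner z z > 0" using False by simp
    ultimately show ?thesis by (simp add: divide_le_0_iff)
  qed simp
  then show ?thesis using that y by blast
qed

text \<open>The orthogonal complement of the kernel of a nonzero \<open>f\<close> is a line; a
  vector spanning it, suitably scaled, represents \<open>f\<close>.\<close>

lemma Riesz_representation:
  fixes f :: "'a::{real_inner,complete_space} \<Rightarrow> real"
  assumes "bounded_linear f"
  obtains w where "\<And>x. f x = inner x w"
proof (cases "\<forall>x. f x = 0")
  case True
  then show ?thesis using that[of 0] by simp
next
  case False
  interpret f: bounded_linear f by fact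
  from False obtain x where x: "f x \<noteq> 0" by blast
  let ?K = "{x. f x = 0}"
  have "subspace ?K" by (auto simp: subspace_def f.zero f.add f.scaleR)
  moreover have "complete ?K"
    unfolding complete_eq_closed
    by (intro closed_Collect_eq continuous_intros linear_continuous_on assms)
  ultimately obtain y where y: "y \<in> ?K" and orth: "\<And>z. z \<in> ?K \<Longrightarrow> inner (x - y) z = 0"
    using complete_subspace_projection by blast
  let ?u = "x - y"
  have fu: "f ?u \<noteq> 0" using x y by (simp add: f.diff)
  then have u: "?u \<noteq> 0" using f.zero by metis
  have "f z = inner z ((f ?u / inner ?u ?u) *\<^sub>R ?u)" for z
  proof -
    have "z - (f z / f ?u) *\<^sub>R ?u \<in> ?K" using fu by (simp add: f.diff f.scaleR)
    from orth[OF this] have "inner z ?u = f z / f ?u * inner ?u ?u"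
      by (simp add: inner_diff_right inner_commute[of ?u z])
    then show ?thesis using fu u by (simp add: inner_scaleR_right del: scaleR_right_diff_distrib)
  qed
  then show ?thesis using that by blast
qed

lemma bounded_linear_adjoint_exists:
  fixes T :: "'a::{real_inner,complete_space} \<Rightarrow> 'b::real_inner"
  assumes "bounded_linear T"
  obtains S where "\<And>x y. inner (T x) y = inner x (S y)"
proof -
  have "\<exists>w. \<forall>x. inner (T x) y = inner x w" for y
    using Riesz_representation[OF bounded_linear_compose[OF bounded_linear_inner_left assms, of y]]
    by metis
  then show ?thesis using that by metis
qed

text \<open>Linearity follows from nondegeneracy of the inner product; the bound of \<open>T\<close>
  carries over through \<parallel>S y\<parallel>^2 = \<langle>T (S y), y\<rangle>.\<close>

lemma bounded_linear_of_adjoint: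
  fixes T :: "'a::real_inner \<Rightarrow> 'b::real_inner"
  assumes T: "bounded_linear T" and adj: "\<And>x y. inner (T x) y = inner x (S y)"
  shows "bounded_linear S"
proof -
  obtain K where "K \<ge> 0" and K: "\<And>x. norm (T x) \<le> norm x * K"
    using bounded_linear.nonneg_bounded[OF T] by blast
  show ?thesis
  proof (rule bounded_linear_intro)
    show "S (x + y) = S x + S y" for x y
      by (rule vector_eq_ldot[THEN iffD1]) (simp add: inner_add_right flip: adj)
    show "S (r *\<^sub>R x) = r *\<^sub>R S x" for r x
      by (rule vector_eq_ldot[THEN iffD1]) (simp flip: adj)
    show "norm (S y) \<le> norm y * K" for y
    proof (cases "S y = 0")
      case True
      then show ?thesis using \<open>K \<ge> 0\<close> by simp
    next
      case False
      have "norm (S y) * norm (S y) = inner (T (S y)) y"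
        by (simp add: adj power2_norm_eq_inner flip: power2_eq_square)
      also have "\<dots> \<le> norm (T (S y)) * norm y" by (rule norm_cauchy_schwarz)
      also have "\<dots> \<le> norm (S y) * K * norm y" by (intro mult_right_mono K) simp
      finally show ?thesis using False by (simp add: mult.assoc mult.commute[of K])
    qed
  qed
qed

section \<open>Minimum modulus of an operator and of its adjoint on an invariant subspace\<close>

lemma minimizer_imp_eigenvector:
  fixes T S :: "'a::real_inner \<Rightarrow> 'a"
  assumes T: "linear T" and adj: "\<And>x y. inner (T x) y = inner x (S y)"
    and M: "subspace M" "T ` M \<subseteq> M" "S ` M \<subseteq> M"
    and le: "\<And>x. x \<in> M \<Longrightarrow> m * norm x \<le> norm (T x)" and m: "m \<ge> 0"
    and x0: "x0 \<in> M" "norm (T x0) = m * norm x0"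
  shows "S (T x0) = m\<^sup>2 *\<^sub>R x0"
proof -
  define h where "h = S (T x0) - m\<^sup>2 *\<^sub>R x0"
  define B where "B = inner h h"
  define q where "q = (norm (T h))\<^sup>2 - m\<^sup>2 * (norm h)\<^sup>2"
  have h: "h \<in> M" unfolding h_def using M x0 by (auto intro!: subspace_diff subspace_scale)
  have B: "B = inner (T x0) (T h) - m\<^sup>2 * inner x0 h"
    unfolding B_def by (subst (2) h_def) (simp add: inner_diff_right adj[of h] inner_commute[of h] inner_commute[of "T x0"])
  \<comment> \<open>The form Q(x) = \<parallel>T x\<parallel>^2 - m^2 \<parallel>x\<parallel>^2 is
    nonnegative on \<open>M\<close> and vanishes at \<open>x0\<close>, where its gradient is
    \<open>2 *\<^sub>R h\<close>. The right-hand side is Q(x0 + t h).\<close>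
  have pos: "0 \<le> 2 * t * B + t\<^sup>2 * q" for t
  proof -
    have "x0 + t *\<^sub>R h \<in> M" using M h x0 by (auto intro!: subspace_add subspace_scale)
    from power_mono[OF le[OF this], of 2] m
    have "m\<^sup>2 * (norm (x0 + t *\<^sub>R h))\<^sup>2 \<le> (norm (T (x0 + t *\<^sub>R h)))\<^sup>2"
      by (simp add: power_mult_distrib)
    moreover have "(norm (T x0))\<^sup>2 = m\<^sup>2 * (norm x0)\<^sup>2"
      using x0 by (simp add: power_mult_distrib)
    ultimately show ?thesis
      by (simp add: B q_def linear_add[OF T] linear_scale[OF T] norm_add_scaleR_power2 algebra_simps)
  qed
  have "B = 0"
  proof (rule ccontr)
    assume "B \<noteq> 0"
    then have B0: "B > 0" by (simp add: B_def)
    \<comment> \<open>A step down the gradient, short enough that the quadratic term is at most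
      \<open>- t * B\<close>, half the size of the linear one. The \<open>+ 1\<close> keeps the
      denominator positive when \<open>q = 0\<close>.\<close>
    define t where "t = - B / (\<bar>q\<bar> + 1)"
    have "2 * t * B + t\<^sup>2 * q \<le> 2 * t * B + t\<^sup>2 * (\<bar>q\<bar> + 1)"
      by (intro add_left_mono mult_left_mono) auto
    also have "t\<^sup>2 * (\<bar>q\<bar> + 1) = - t * B"
      unfolding t_def by (simp add: power2_eq_square field_simps add_nonneg_eq_0_iff)
    finally have "0 \<le> t * B" using pos[of t] by linarith
    moreover have "t < 0" using B0 unfolding t_def by (simp add: divide_less_0_iff add_nonneg_pos)
    ultimately show False using B0 by (simp add: zero_le_mult_iff)
  qed
  then show ?thesis by (simp add: B_def h_def)
qed

lemma bounded_below_image_eq: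
  fixes T S :: "'a::real_inner \<Rightarrow> 'a"
  assumes T: "bounded_linear T" and adj: "\<And>x y. inner (T x) y = inner x (S y)"
    and M: "subspace M" "complete M" "T ` M \<subseteq> M" "S ` M \<subseteq> M"
    and le: "\<And>x. x \<in> M \<Longrightarrow> m * norm x \<le> norm (T x)" and m: "m > 0"
    and inj: "\<And>y. y \<in> M \<Longrightarrow> S y = 0 \<Longrightarrow> y = 0"
  shows "T ` M = M"
proof -
  have "complete (T ` M)"
    using complete_isometric_image[OF m M(1) T _ M(2)] le by simp
  moreover have "subspace (T ` M)"
    by (intro linear_subspace_image bounded_linear.linear T M)
  moreover have "y \<in> T ` M" if y: "y \<in> M" for y
  proof -
    obtain p where p: "p \<in> T ` M" and orth: "\<And>z. z \<in> T ` M \<Longrightarrow> inner (y - p) z = 0"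
      using complete_subspace_projection calculation by blast
    \<comment> \<open>The residual is orthogonal to \<open>T (S (y - p))\<close>, so \<parallel>S (y
      - p)\<parallel>^2 = 0 and injectivity of \<open>S\<close> on \<open>M\<close> removes
      it.\<close>
    have u: "y - p \<in> M" using p M y by (auto intro: subspace_diff)
    then have "inner (S (y - p)) (S (y - p)) = 0"
      using orth[of "T (S (y - p))"] M(4) by (auto simp: adj inner_commute[of "y - p"])
    then have "y - p = 0" using inj[OF u] by simp
    then show ?thesis using p by simp
  qed
  ultimately show ?thesis using M(3) by blast
qed

lemma attains_minimum_adjoint:
  fixes T S :: "'a::real_inner \<Rightarrow> 'a"
  assumes T: "bounded_linear T" and adj: "\<And>x y. inner (T x) y = inner x (S y)"
    and M: "subspace M" "complete M" "T ` M \<subseteq> M" "S ` M \<subseteq> M"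
    and ker: "\<And>x. x \<in> M \<Longrightarrow> T x = 0 \<longleftrightarrow> S x = 0"
    and x0: "x0 \<in> M" "norm x0 = 1"
    and min: "\<And>x. x \<in> M \<Longrightarrow> norm x = 1 \<Longrightarrow> norm (T x0) \<le> norm (T x)"
  obtains y0 where "y0 \<in> M" "norm y0 = 1"
    "\<And>y. y \<in> M \<Longrightarrow> norm y = 1 \<Longrightarrow> norm (S y0) \<le> norm (S y)"
proof (cases "T x0 = 0")
  case True
  \<comment> \<open>\<open>x0\<close> lies in both kernels, so \<open>S\<close> attains the value 0
    there.\<close>
  then show ?thesis using that[of x0] x0 ker by simp
next
  case False
  define m where "m = norm (T x0)"
  have m: "m > 0" using False by (simp add: m_def)
  interpret T: bounded_linear T by fact
  interpret S: bounded_linear S by (rule bounded_linear_of_adjoint[OF T adj])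
  have le: "m * norm x \<le> norm (T x)" if "x \<in> M" for x
  proof (cases "x = 0")
    case False
    then have "m \<le> norm (T (x /\<^sub>R norm x))"
      unfolding m_def using that M by (intro min) (auto intro: subspace_scale)
    then show ?thesis using False by (simp add: T.scaleR field_simps)
  qed (simp add: T.zero)
  have inj: "y = 0" if "y \<in> M" "S y = 0" for y
    using le[OF that(1)] ker[OF that(1)] that(2) m by (simp add: mult_le_0_iff)
  have eig: "S (T x0) = m\<^sup>2 *\<^sub>R x0"
    by (rule minimizer_imp_eigenvector[OF T.linear adj M(1,3,4) le])
      (use m x0 in \<open>auto simp: m_def\<close>)
  have Sle: "m * norm y \<le> norm (S y)" if "y \<in> M" for y
  proof (cases "y = 0")
    case False
    from that obtain x where x: "x \<in> M" "y = T x"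
      using bounded_below_image_eq[OF T adj M le m inj] by blast
    have "norm x > 0" using False x T.zero by auto
    \<comment> \<open>Multiply m \<parallel>x\<parallel> \<le> \<parallel>y\<parallel> by
      \<parallel>y\<parallel>; after Cauchy-Schwarz the factor \<parallel>x\<parallel>
      cancels.\<close>
    have "norm x * (m * norm y) \<le> norm y * norm y"
      using mult_right_mono[OF le[OF x(1)], of "norm y"] x(2) by (simp add: mult_ac)
    also have "\<dots> = inner x (S y)"
      using x(2) by (simp add: power2_norm_eq_inner flip: power2_eq_square adj)
    also have "\<dots> \<le> norm x * norm (S y)" by (rule norm_cauchy_schwarz)
    finally show ?thesis using \<open>norm x > 0\<close> by simp
  qed simp
  show ?thesis
  proof (rule that)
    show "T x0 /\<^sub>R m \<in> M" using M x0 by (auto intro: subspace_scale)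
    show "norm (T x0 /\<^sub>R m) = 1" using m by (simp add: m_def)
    fix y assume "y \<in> M" "norm y = 1"
    then have "m \<le> norm (S y)" using Sle[of y] by simp
    also have "m = norm (S (T x0 /\<^sub>R m))"
      using m x0 by (simp add: S.scaleR eig power2_eq_square)
    finally show "norm (S (T x0 /\<^sub>R m)) \<le> norm (S y)" by simp
  qed
qed

text \<open>Replaces the infimum by comparison with every unit vector, the form used in
  \<open>attains_minimum_adjoint\<close>. The norms are bounded below by 0, so an attained infimum
  is the same as a minimum.\<close>

lemma minimum_attaining_on_iff:
  "minimum_attaining_on M A \<longleftrightarrow>
    (\<exists>x0\<in>M. norm x0 = 1 \<and> (\<forall>x\<in>M. norm x = 1 \<longrightarrow> norm (A x0) \<le> norm (A x)))"
proof -
  have bdd: "bdd_below {norm (A x) | x. x \<in> M \<and> norm x = 1}"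
    by (auto intro!: bdd_belowI[of _ 0])
  have "norm (A x0) = min_modulus_on M A \<longleftrightarrow> (\<forall>x\<in>M. norm x = 1 \<longrightarrow> norm (A x0) \<le> norm (A x))"
    if "x0 \<in> M" "norm x0 = 1" for x0
  proof
    assume "norm (A x0) = min_modulus_on M A"
    then show "\<forall>x\<in>M. norm x = 1 \<longrightarrow> norm (A x0) \<le> norm (A x)"
      unfolding min_modulus_on_def by (auto intro!: cInf_lower[OF _ bdd])
  next
    assume "\<forall>x\<in>M. norm x = 1 \<longrightarrow> norm (A x0) \<le> norm (A x)"
    then show "norm (A x0) = min_modulus_on M A"
      unfolding min_modulus_on_def using that
      by (intro cInf_eq_minimum[symmetric]) auto
  qed
  then show ?thesis unfolding minimum_attaining_on_def by blast
qed

section \<open>The complex adjoint\<close>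

lemma csubspace_imp_subspace:
  assumes "csubspace M"
  shows "subspace M"
  using assms complex_vector.subspace_0 complex_vector.subspace_add complex_vector.subspace_scale
  by (auto simp: subspace_def scaleR_scaleC)

lemma cinner_eqI:
  fixes x y :: "'a::complex_inner"
  assumes "\<And>z. cinner z x = cinner z y"
  shows "x = y"
  by (rule vector_eq_ldot[THEN iffD1]) (simp add: inner_eq_Re_cinner assms)

lemma cinner_scaleC_right: "cinner x (a *\<^sub>C y) = cnj a * cinner x y"
  by (subst (1 2) cinner_commute) (simp add: cinner_scaleC_left)

text \<open>Any \<open>S\<close> with the adjoint identity shows that the choice in
  \<open>cadjoint\<close> satisfies it too; nondegeneracy then makes the two equal.\<close>

lemma cadjoint_eqI:
  assumes "\<And>x y. cinner (T x) y = cinner x (S y)"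
  shows "cadjoint T = S"
proof -
  have "\<forall>x y. cinner (T x) y = cinner x (cadjoint T y)"
    unfolding cadjoint_def by (rule someI[of _ S]) (simp add: assms)
  then have "cinner x (cadjoint T y) = cinner x (S y)" for x y
    by (simp flip: assms)
  then show ?thesis
    by (intro ext cinner_eqI)
qed

lemma cinner_cadjoint:
  assumes "bounded_clinear T"
  shows "cinner (T x) y = cinner x (cadjoint T y)"
proof -
  obtain S where S: "\<And>x y. inner (T x) y = inner x (S y)"
    using bounded_linear_adjoint_exists[of T] assms by (auto simp: bounded_clinear_def)
  have Re: "Re (cinner (T x) y) = Re (cinner x (S y))" for x y
    using S[of x y] by (simp add: inner_eq_Re_cinner)
  have "cinner (T x) y = cinner x (S y)" for x y
  proof (rule complex_eqI)
    \<comment> \<open>Im c = - Re (i c), so the real identity at \<open>\<i> *\<^sub>C x\<close>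
      gives the imaginary part at \<open>x\<close>.\<close>
    have "T (\<i> *\<^sub>C x) = \<i> *\<^sub>C T x" using assms by (simp add: bounded_clinear_def)
    then show "Im (cinner (T x) y) = Im (cinner x (S y))"
      using Re[of "\<i> *\<^sub>C x" y] by (simp add: cinner_scaleC_left)
  qed (rule Re)
  then show ?thesis using cadjoint_eqI[of T S] by simp
qed

lemma inner_cadjoint:
  "bounded_clinear T \<Longrightarrow> inner (T x) y = inner x (cadjoint T y)"
  by (simp add: inner_eq_Re_cinner cinner_cadjoint)

lemma bounded_clinear_cadjoint:
  assumes "bounded_clinear T"
  shows "bounded_clinear (cadjoint T)"
  unfolding bounded_clinear_def
proof (intro conjI allI)
  show "bounded_linear (cadjoint T)"
    using bounded_linear_of_adjoint[of T] assms inner_cadjoint by (auto simp: bounded_clinear_def)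
  show "cadjoint T (a *\<^sub>C x) = a *\<^sub>C cadjoint T x" for a x
    by (rule cinner_eqI) (simp add: cinner_scaleC_right flip: cinner_cadjoint[OF assms])
qed

lemma cadjoint_cadjoint:
  assumes "bounded_clinear T"
  shows "cadjoint (cadjoint T) = T"
proof (rule cadjoint_eqI)
  fix x y
  have "cinner (cadjoint T x) y = cnj (cinner y (cadjoint T x))"
    by (rule cinner_commute)
  also have "\<dots> = cnj (cinner (T y) x)"
    by (simp add: cinner_cadjoint[OF assms])
  also have "\<dots> = cinner x (T y)"
    by (rule cinner_commute[symmetric])
  finally show "cinner (cadjoint T x) y = cinner x (T y)" .
qed

section \<open>Reducing subspaces and WEP operators under passage to the adjoint\<close>

lemma reduces_cadjoint:
  "bounded_clinear T \<Longrightarrow> reduces M (cadjoint T) \<longleftrightarrow> reduces M T"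
  by (auto simp: reduces_def cadjoint_cadjoint)

lemma wep_cadjoint: "bounded_clinear T \<Longrightarrow> wep (cadjoint T) \<longleftrightarrow> wep T"
  by (auto simp: wep_def cadjoint_cadjoint)

text \<open>The kernel of each of \<open>T\<close> and \<open>cadjoint T\<close> is the orthogonal
  complement of the range of the other, and the ranges agree.\<close>

lemma wep_kernel:
  assumes T: "bounded_clinear T" and "wep T"
  shows "T x = 0 \<longleftrightarrow> cadjoint T x = 0"
proof -
  have "T x = 0 \<longleftrightarrow> (\<forall>w. inner (T x) w = 0)"
    using inner_eq_zero_iff[of "T x"] by auto
  also have "\<dots> \<longleftrightarrow> (\<forall>z\<in>range (cadjoint T). inner x z = 0)"
    by (simp add: inner_cadjoint[OF T])
  also have "\<dots> \<longleftrightarrow> (\<forall>z\<in>range T. inner x z = 0)"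
    using \<open>wep T\<close> by (simp add: wep_def)
  also have "\<dots> \<longleftrightarrow> (\<forall>w. inner (cadjoint T x) w = 0)"
    by (metis (no_types, lifting) inner_cadjoint[OF T] inner_commute rangeE rangeI)
  also have "\<dots> \<longleftrightarrow> cadjoint T x = 0"
    using inner_eq_zero_iff[of "cadjoint T x"] by auto
  finally show ?thesis .
qed

lemma cadjoint_reducing_minimum_attaining:
  assumes T: "T \<in> \<M>\<^sub>r" and "wep T"
  shows "cadjoint T \<in> \<M>\<^sub>r"
proof -
  have bc: "bounded_clinear T" using T by (simp add: reducing_minimum_attaining_def)
  have "minimum_attaining_on M (cadjoint T)"
    if M: "csubspace M" "closed M" "M \<noteq> {0}" "reduces M (cadjoint T)" for M
  proof -
    have red: "reduces M T" using M bc by (simp add: reduces_cadjoint)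
    then have "minimum_attaining_on M T"
      using T M by (simp add: reducing_minimum_attaining_def)
    then obtain x0 where x0: "x0 \<in> M" "norm x0 = 1"
      and min: "\<And>x. x \<in> M \<Longrightarrow> norm x = 1 \<Longrightarrow> norm (T x0) \<le> norm (T x)"
      unfolding minimum_attaining_on_iff by blast
    have *: "bounded_linear T" "subspace M" "complete M" "T ` M \<subseteq> M" "cadjoint T ` M \<subseteq> M"
      using bc red M by (auto simp: bounded_clinear_def reduces_def complete_eq_closed
          csubspace_imp_subspace)
    obtain y0 where "y0 \<in> M" "norm y0 = 1"
      "\<And>y. y \<in> M \<Longrightarrow> norm y = 1 \<Longrightarrow> norm (cadjoint T y0) \<le> norm (cadjoint T y)"
      using attains_minimum_adjoint[OF *(1) inner_cadjoint[OF bc] *(2-) wep_kernel[OF bc \<open>wep T\<close>] x0 min]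
      by blast
    then show ?thesis unfolding minimum_attaining_on_iff by blast
  qed
  then show ?thesis
    using bounded_clinear_cadjoint[OF bc] by (simp add: reducing_minimum_attaining_def)
qed

theorem proposition3p12:
  fixes T :: "'a::chilbert_space \<Rightarrow> 'a"
  assumes "infinite_dimensional TYPE('a)"
    and "separable_space (euclidean :: 'a topology)"
    and "bounded_clinear T"
    and "wep T"
  shows "T \<in> \<M>\<^sub>r \<longleftrightarrow> cadjoint T \<in> \<M>\<^sub>r"
proof
  assume "T \<in> \<M>\<^sub>r"
  then show "cadjoint T \<in> \<M>\<^sub>r"
    using \<open>wep T\<close> by (rule cadjoint_reducing_minimum_attaining)
next
  assume "cadjoint T \<in> \<M>\<^sub>r"
  \<comment> \<open>The hypotheses are symmetric in \<open>T\<close> and its adjoint, so the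
    converse is the first implication applied to \<open>cadjoint T\<close>.\<close>
  then have "cadjoint (cadjoint T) \<in> \<M>\<^sub>r"
    by (rule cadjoint_reducing_minimum_attaining) (simp add: wep_cadjoint assms)
  then show "T \<in> \<M>\<^sub>r" by (simp add: cadjoint_cadjoint assms)
qed

end
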